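(* Let $\zeta,R$ be real constants, $\Delta t>0$ with $\zeta\Delta t\ne2$, $w_0\in(0,1)$ and $s_1,s_2,s_4,s_5\in(0,2)$. The D2Q5 MRT-LB-AL model for the diffusion equation with linear source $\zeta\phi+R$ is equivalent to a six-level finite-difference scheme in the following sense: for every evolution $(f_i)_{i=0}^4$ of the model on the lattice, with arbitrary initial data at time level $0$, the macroscopic variable $\phi=\left(\sum_i f_i+\frac{\Delta t}{2}R\right)/\left(1-\frac{\zeta\Delta t}{2}\right)$ satisfies, for all $n\ge4$ and $i,j\in\mathbb Z$, $$\begin{aligned}\phi_{i,j}^{n+1}=&\ \overline\alpha_1\phi^n_{i,j}+\overline\alpha_2\,\Sigma_1\phi^n_{i,j}+\overline\beta_1\phi^{n-1}_{i,j}+\overline\beta_2\,\Sigma_1\phi^{n-1}_{i,j}+\overline\beta_3\,\Sigma_2\phi^{n-1}_{i,j}+\overline\gamma_1\phi^{n-2}_{i,j}+\overline\gamma_2\,\Sigma_1\phi^{n-2}_{i,j}+\overline\gamma_3\,\Sigma_2\phi^{n-2}_{i,j}\\&+\overline\zeta_1\phi^{n-3}_{i,j}+\overline\zeta_2\,\Sigma_1\phi^{n-3}_{i,j}+\overline\eta\,\phi^{n-4}_{i,j}+\Delta t\,\overline\delta R,\end{aligned}$$ where, with $\mu=\frac{2}{2-\zeta\Delta t}$, $$\begin{aligned} &\overline\alpha_1=\mu\big[\alpha_1-\tfrac{\zeta\Delta t}{2}\big(w_0(s_4-2)+1-s_4\big)\big],\\ &\overline\alpha_2=\mu\big[\alpha_2-\tfrac{\zeta\Delta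 t}{8}\big(2-2s_2-s_5+w_0(2-s_4)\big)\big],\\ &\overline\beta_1=\mu\big[\beta_1+\tfrac{\zeta\Delta t}{8}\big(4w_0(s_2-1)(s_4-2)+4s_5(s_2-1)\big)\big],\\ &\overline\beta_2=\mu\big[\beta_2+\tfrac{\zeta\Delta t}{8}\big((s_4-1)(2s_2+s_5-2)-w_0(s_4-2)(2s_2+s_5-3)\big)\big],\\ &\overline\beta_3=\mu\big[\beta_3+\tfrac{\zeta\Delta t}{8}\big(w_0(s_4-2)(s_2+s_5-2)+s_2(s_2+s_5-2)\big)\big],\\ &\overline\gamma_1=\mu\big[\gamma_1+\tfrac{\zeta\Delta t}{8}\big(4s_5(s_2-1)(s_4-1)-4w_0(s_2-1)(s_4-2)(s_5-1)\big)\big],\\ &\overline\gamma_2=\mu\big[\gamma_2+\tfrac{\zeta\Delta t}{8}\big((s_2-1)(s_5+s_2s_5-2)+w_0(s_2-1)(s_4-2)(s_2+2s_5-3)\big)\big],\\ &\overline\gamma_3=\mu\big[\gamma_3+\tfrac{\zeta\Delta t}{8}\big(s_2(s_4-1)(s_2+s_5-2)-w_0(s_2-1)(s_4-2)(s_2+s_5-2)\big)\big],\\ &\overline\zeta_1=\mu\big[\zeta_1-\tfrac{\zeta\Delta t(1-s_2)}{8}\big(4(1-s_2)(1-s_5)+4w_0(s_2-1)(s_4-2)(s_5-1)\big)\big],\\ &\overline\zeta_2=\mu\big[\zeta_2-\tfrac{\zeta\Delta t(1-s_2)}{8}\big((s_4-1)(s_5+s_2s_5-2)-w_0(s_2-1)(s_4-2)(s_5-1)\big)\big],\\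 &\overline\eta=\mu\big[\eta+\tfrac{\zeta\Delta t}{2}(s_2-1)^2(s_4-1)(s_5-1)\big],\qquad \overline\delta=\mu\,\delta. \end{aligned}$$
   Context: **Setting.** The equation is $\partial_t\phi=\nabla\cdot(\kappa\nabla\phi)+\zeta\phi+R$ in two space dimensions with constants $\kappa,\zeta,R$. The lattice is $\Delta x\,\mathbb Z\times\Delta x\,\mathbb Z$, times are $n\Delta t$, $c=\Delta x/\Delta t$, and $\phi^n_{i,j}$ is the value at $(i\Delta x,j\Delta x)$ and time $n\Delta t$. **MRT-LB-AL model (D2Q5).** The discrete velocities are $\mathbf c_0=c(0,0)$, $\mathbf c_1=c(1,0)$, $\mathbf c_2=c(0,1)$, $\mathbf c_3=c(-1,0)$, $\mathbf c_4=c(0,-1)$. The distribution functions evolve by $$f_i(\mathbf r+\mathbf c_i\Delta t,t+\Delta t)=f_i(\mathbf r,t)-\sum_k(M^{-1}SM)_{ik}[f_k-f_k^{eq}](\mathbf r,t)+\Delta t\sum_k\big(I-\tfrac12M^{-1}SM\big)_{ik}\tilde R_k(\mathbf r,t),$$ with $f_i^{eq}=w_i\phi$, $\tilde R_i=w_i(\zeta\phi+R)$, $w_1=\dots=w_4=(1-w_0)/4$, $\phi=\big(\sum_if_i+\frac{\Delta t}{2}R\big)/\big(1-\frac{\zeta\Delta t}{2}\big)$, $S=\mathrm{diag}(s_1,s_2,s_2,s_4,s_5)$, and $$M=\begin{pmatrix}1&1&1&1&1\\0&c&0&-c&0\\0&0&c&0&-c\\-4c^2&c^2&c^2&c^2&c^2\\0&c^2&-c^2&c^2&-c^2\end{pmatrix}.$$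 **Notation.** $\Sigma_1\phi_{i,j}=\phi_{i-1,j}+\phi_{i+1,j}+\phi_{i,j-1}+\phi_{i,j+1}$, $\Sigma_2\phi_{i,j}=\phi_{i-1,j-1}+\phi_{i-1,j+1}+\phi_{i+1,j-1}+\phi_{i+1,j+1}$. The coefficients without bars are as follows ($\zeta_1,\zeta_2$ are coefficients distinct from the source constant $\zeta$): $$\begin{aligned} &\alpha_1=(w_0-1)s_4+1,\quad \alpha_2=1-\tfrac{s_5}{4}-\tfrac{s_2}{2}-\tfrac{s_4w_0}{4},\quad \beta_1=(s_4w_0+s_5-2)(1-s_2),\\ &\beta_2=\tfrac{(s_5+2s_2-4)(1-s_4)+w_0s_4(s_5+2s_2-3)}{4},\quad \beta_3=\tfrac{(2-s_2-s_4w_0)(s_2+s_5-2)}{4},\\ &\gamma_1=s_4w_0(s_2-1)(s_5-1)+(1-s_4)(s_5-2)(s_2-1),\\ &\gamma_2=\tfrac{(s_2-1)\left(s_4w_0(3-s_2-2s_5)+(2s_2+3s_5-s_2s_5-4)\right)}{4},\\ &\gamma_3=\tfrac{w_0s_4(s_2-1)(s_2+s_5-2)+(1-s_4)(s_2-2)(s_2+s_5-2)}{4},\\ &\zeta_1=(w_0s_4-1)(1-s_5)(s_2-1)^2,\\ &\zeta_2=\tfrac{s_4w_0(s_2-1)^2(s_5-1)+(1-s_4)(1-s_2)(2s_2+3s_5-s_2s_5-4)}{4},\\ &\eta=(1-s_2)^2(1-s_4)(1-s_5),\quad \delta=s_2^2s_4s_5. \end{aligned}$$ *)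

theory Defs
  imports "HOL-Analysis.Analysis"
begin

(* Families indexed by 0, ..., 4, as in the numbering f_0, ..., f_4. The elements of the
   index type 5 are exactly 0, 1, 2, 3, 4 (arithmetic modulo 5); the library's "vector"
   counts from 1 and would put the rest velocity last. *)
definition vec5 :: "'a \<Rightarrow> 'a \<Rightarrow> 'a \<Rightarrow> 'a \<Rightarrow> 'a \<Rightarrow> 'a ^ 5" where
  "vec5 a0 a1 a2 a3 a4 =
    (\<chi> k. if k = 0 then a0 else if k = 1 then a1 else if k = 2 then a2
         else if k = 3 then a3 else a4)"

definition lattice :: "real \<Rightarrow> (real \<times> real) set" where
  "lattice dx = {(of_int i * dx, of_int j * dx) | i j :: int. True}"

definition time_levels :: "real \<Rightarrow> real set" where
  "time_levels dt = {of_nat n * dt | n :: nat. True}"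

definition velocity :: "real \<Rightarrow> (real \<times> real) ^ 5" where
  "velocity c = vec5 (c *\<^sub>R (0, 0)) (c *\<^sub>R (1, 0)) (c *\<^sub>R (0, 1)) (c *\<^sub>R (-1, 0)) (c *\<^sub>R (0, -1))"

definition weight :: "real \<Rightarrow> real ^ 5" where
  "weight w0 = vec5 w0 ((1 - w0) / 4) ((1 - w0) / 4) ((1 - w0) / 4) ((1 - w0) / 4)"

definition moment_matrix :: "real \<Rightarrow> real ^ 5 ^ 5" where
  "moment_matrix c = vec5
    (vec5 1            1       1          1       1)
    (vec5 0            c       0          (- c)   0)
    (vec5 0            0       c          0       (- c))
    (vec5 (- 4 * c^2)  (c^2)   (c^2)      (c^2)   (c^2))
    (vec5 0            (c^2)   (- (c^2))  (c^2)   (- (c^2)))"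

definition relaxation_matrix :: "real \<Rightarrow> real \<Rightarrow> real \<Rightarrow> real \<Rightarrow> real ^ 5 ^ 5" where
  "relaxation_matrix s1 s2 s4 s5 = (\<chi> i k. if i = k then vec5 s1 s2 s2 s4 s5 $ i else 0)"

definition collision_matrix :: "real \<Rightarrow> real \<Rightarrow> real \<Rightarrow> real \<Rightarrow> real \<Rightarrow> real ^ 5 ^ 5" where
  "collision_matrix c s1 s2 s4 s5 =
    matrix_inv (moment_matrix c) ** relaxation_matrix s1 s2 s4 s5 ** moment_matrix c"

definition macroscopic :: "real \<Rightarrow> real \<Rightarrow> real \<Rightarrow> real ^ 5 \<Rightarrow> real" where
  "macroscopic \<zeta> R dt g = ((\<Sum>k\<in>UNIV. g $ k) + dt / 2 * R) / (1 - \<zeta> * dt / 2)"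

definition equilibrium :: "real \<Rightarrow> real \<Rightarrow> real ^ 5" where
  "equilibrium w0 u = (\<chi> k. weight w0 $ k * u)"

definition source_term :: "real \<Rightarrow> real \<Rightarrow> real \<Rightarrow> real \<Rightarrow> real ^ 5" where
  "source_term w0 \<zeta> R u = (\<chi> k. weight w0 $ k * (\<zeta> * u + R))"

(* f r t $ k is the distribution function f_k at position r and time t. Only its values on
   lattice dx and time_levels dt are constrained; those at time 0 are free. *)
definition MRT_LB_evolution ::
  "real \<Rightarrow> real \<Rightarrow> real \<Rightarrow> real \<Rightarrow> real \<Rightarrow> real \<Rightarrow> real \<Rightarrow> real \<Rightarrow> real
    \<Rightarrow> (real \<times> real \<Rightarrow> real \<Rightarrow> real ^ 5) \<Rightarrow> bool" where
  "MRT_LB_evolution dx dt \<zeta> R w0 s1 s2 s4 s5 f \<longleftrightarrow>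
    (let c = dx / dt; L = collision_matrix c s1 s2 s4 s5 in
     \<forall>r \<in> lattice dx. \<forall>t \<in> time_levels dt. \<forall>i.
       (let \<phi> = macroscopic \<zeta> R dt (f r t) in
        f (r + dt *\<^sub>R (velocity c $ i)) (t + dt) $ i =
          f r t $ i
          - (\<Sum>k\<in>UNIV. L $ i $ k * (f r t $ k - equilibrium w0 \<phi> $ k))
          + dt * (\<Sum>k\<in>UNIV. (mat 1 - (1 / 2) *\<^sub>R L) $ i $ k * source_term w0 \<zeta> R \<phi> $ k)))"

definition Sigma1 :: "(int \<Rightarrow> int \<Rightarrow> real) \<Rightarrow> int \<Rightarrow> int \<Rightarrow> real" where
  "Sigma1 u i j = u (i - 1) j + u (i + 1) j + u i (j - 1) + u i (j + 1)"

definition Sigma2 :: "(int \<Rightarrow> int \<Rightarrow> real) \<Rightarrow> int \<Rightarrow> int \<Rightarrow> real" where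
  "Sigma2 u i j =
    u (i - 1) (j - 1) + u (i - 1) (j + 1) + u (i + 1) (j - 1) + u (i + 1) (j + 1)"

(* Coefficients of the scheme. For uniformity all of them take the same arguments, whether
   used or not. zeta1 and zeta2 are unrelated to the source constant \<zeta>. *)

definition alpha1 :: "real \<Rightarrow> real \<Rightarrow> real \<Rightarrow> real \<Rightarrow> real" where
  "alpha1 w0 s2 s4 s5 =
    (w0 - 1) * s4 + 1"

definition alpha2 :: "real \<Rightarrow> real \<Rightarrow> real \<Rightarrow> real \<Rightarrow> real" where
  "alpha2 w0 s2 s4 s5 =
    1 - s5 / 4 - s2 / 2 - s4 * w0 / 4"

definition beta1 :: "real \<Rightarrow> real \<Rightarrow> real \<Rightarrow> real \<Rightarrow> real" where
  "beta1 w0 s2 s4 s5 =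
    (s4 * w0 + s5 - 2) * (1 - s2)"

definition beta2 :: "real \<Rightarrow> real \<Rightarrow> real \<Rightarrow> real \<Rightarrow> real" where
  "beta2 w0 s2 s4 s5 =
    ((s5 + 2 * s2 - 4) * (1 - s4) + w0 * s4 * (s5 + 2 * s2 - 3)) / 4"

definition beta3 :: "real \<Rightarrow> real \<Rightarrow> real \<Rightarrow> real \<Rightarrow> real" where
  "beta3 w0 s2 s4 s5 =
    (2 - s2 - s4 * w0) * (s2 + s5 - 2) / 4"

definition gamma1 :: "real \<Rightarrow> real \<Rightarrow> real \<Rightarrow> real \<Rightarrow> real" where
  "gamma1 w0 s2 s4 s5 =
    s4 * w0 * (s2 - 1) * (s5 - 1) + (1 - s4) * (s5 - 2) * (s2 - 1)"

definition gamma2 :: "real \<Rightarrow> real \<Rightarrow> real \<Rightarrow> real \<Rightarrow> real" where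
  "gamma2 w0 s2 s4 s5 =
    (s2 - 1) * (s4 * w0 * (3 - s2 - 2 * s5) + (2 * s2 + 3 * s5 - s2 * s5 - 4)) / 4"

definition gamma3 :: "real \<Rightarrow> real \<Rightarrow> real \<Rightarrow> real \<Rightarrow> real" where
  "gamma3 w0 s2 s4 s5 =
    (w0 * s4 * (s2 - 1) * (s2 + s5 - 2) + (1 - s4) * (s2 - 2) * (s2 + s5 - 2)) / 4"

definition zeta1 :: "real \<Rightarrow> real \<Rightarrow> real \<Rightarrow> real \<Rightarrow> real" where
  "zeta1 w0 s2 s4 s5 =
    (w0 * s4 - 1) * (1 - s5) * (s2 - 1)^2"

definition zeta2 :: "real \<Rightarrow> real \<Rightarrow> real \<Rightarrow> real \<Rightarrow> real" where
  "zeta2 w0 s2 s4 s5 =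
    (s4 * w0 * (s2 - 1)^2 * (s5 - 1)
      + (1 - s4) * (1 - s2) * (2 * s2 + 3 * s5 - s2 * s5 - 4)) / 4"

definition eta :: "real \<Rightarrow> real \<Rightarrow> real \<Rightarrow> real \<Rightarrow> real" where
  "eta w0 s2 s4 s5 =
    (1 - s2)^2 * (1 - s4) * (1 - s5)"

definition delta :: "real \<Rightarrow> real \<Rightarrow> real \<Rightarrow> real \<Rightarrow> real" where
  "delta w0 s2 s4 s5 =
    s2^2 * s4 * s5"

definition mu :: "real \<Rightarrow> real \<Rightarrow> real" where
  "mu \<zeta> dt = 2 / (2 - \<zeta> * dt)"

definition alpha1_bar :: "real \<Rightarrow> real \<Rightarrow> real \<Rightarrow> real \<Rightarrow> real \<Rightarrow> real \<Rightarrow> real" where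
  "alpha1_bar \<zeta> dt w0 s2 s4 s5 =
    mu \<zeta> dt * (alpha1 w0 s2 s4 s5
      - \<zeta> * dt / 2 * (w0 * (s4 - 2) + 1 - s4))"

definition alpha2_bar :: "real \<Rightarrow> real \<Rightarrow> real \<Rightarrow> real \<Rightarrow> real \<Rightarrow> real \<Rightarrow> real" where
  "alpha2_bar \<zeta> dt w0 s2 s4 s5 =
    mu \<zeta> dt * (alpha2 w0 s2 s4 s5
      - \<zeta> * dt / 8 * (2 - 2 * s2 - s5 + w0 * (2 - s4)))"

definition beta1_bar :: "real \<Rightarrow> real \<Rightarrow> real \<Rightarrow> real \<Rightarrow> real \<Rightarrow> real \<Rightarrow> real" where
  "beta1_bar \<zeta> dt w0 s2 s4 s5 =
    mu \<zeta> dt * (beta1 w0 s2 s4 s5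
      + \<zeta> * dt / 8 * (4 * w0 * (s2 - 1) * (s4 - 2) + 4 * s5 * (s2 - 1)))"

definition beta2_bar :: "real \<Rightarrow> real \<Rightarrow> real \<Rightarrow> real \<Rightarrow> real \<Rightarrow> real \<Rightarrow> real" where
  "beta2_bar \<zeta> dt w0 s2 s4 s5 =
    mu \<zeta> dt * (beta2 w0 s2 s4 s5
      + \<zeta> * dt / 8 * ((s4 - 1) * (2 * s2 + s5 - 2) - w0 * (s4 - 2) * (2 * s2 + s5 - 3)))"

definition beta3_bar :: "real \<Rightarrow> real \<Rightarrow> real \<Rightarrow> real \<Rightarrow> real \<Rightarrow> real \<Rightarrow> real" where
  "beta3_bar \<zeta> dt w0 s2 s4 s5 =
    mu \<zeta> dt * (beta3 w0 s2 s4 s5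
      + \<zeta> * dt / 8 * (w0 * (s4 - 2) * (s2 + s5 - 2) + s2 * (s2 + s5 - 2)))"

definition gamma1_bar :: "real \<Rightarrow> real \<Rightarrow> real \<Rightarrow> real \<Rightarrow> real \<Rightarrow> real \<Rightarrow> real" where
  "gamma1_bar \<zeta> dt w0 s2 s4 s5 =
    mu \<zeta> dt * (gamma1 w0 s2 s4 s5
      + \<zeta> * dt / 8 * (4 * s5 * (s2 - 1) * (s4 - 1) - 4 * w0 * (s2 - 1) * (s4 - 2) * (s5 - 1)))"

definition gamma2_bar :: "real \<Rightarrow> real \<Rightarrow> real \<Rightarrow> real \<Rightarrow> real \<Rightarrow> real \<Rightarrow> real" where
  "gamma2_bar \<zeta> dt w0 s2 s4 s5 =
    mu \<zeta> dt * (gamma2 w0 s2 s4 s5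
      + \<zeta> * dt / 8 * ((s2 - 1) * (s5 + s2 * s5 - 2) + w0 * (s2 - 1) * (s4 - 2) * (s2 + 2 * s5 - 3)))"

definition gamma3_bar :: "real \<Rightarrow> real \<Rightarrow> real \<Rightarrow> real \<Rightarrow> real \<Rightarrow> real \<Rightarrow> real" where
  "gamma3_bar \<zeta> dt w0 s2 s4 s5 =
    mu \<zeta> dt * (gamma3 w0 s2 s4 s5
      + \<zeta> * dt / 8 * (s2 * (s4 - 1) * (s2 + s5 - 2) - w0 * (s2 - 1) * (s4 - 2) * (s2 + s5 - 2)))"

definition zeta1_bar :: "real \<Rightarrow> real \<Rightarrow> real \<Rightarrow> real \<Rightarrow> real \<Rightarrow> real \<Rightarrow> real" where
  "zeta1_bar \<zeta> dt w0 s2 s4 s5 =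
    mu \<zeta> dt * (zeta1 w0 s2 s4 s5
      - \<zeta> * dt * (1 - s2) / 8 * (4 * (1 - s2) * (1 - s5) + 4 * w0 * (s2 - 1) * (s4 - 2) * (s5 - 1)))"

definition zeta2_bar :: "real \<Rightarrow> real \<Rightarrow> real \<Rightarrow> real \<Rightarrow> real \<Rightarrow> real \<Rightarrow> real" where
  "zeta2_bar \<zeta> dt w0 s2 s4 s5 =
    mu \<zeta> dt * (zeta2 w0 s2 s4 s5
      - \<zeta> * dt * (1 - s2) / 8 * ((s4 - 1) * (s5 + s2 * s5 - 2) - w0 * (s2 - 1) * (s4 - 2) * (s5 - 1)))"

definition eta_bar :: "real \<Rightarrow> real \<Rightarrow> real \<Rightarrow> real \<Rightarrow> real \<Rightarrow> real \<Rightarrow> real" where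
  "eta_bar \<zeta> dt w0 s2 s4 s5 =
    mu \<zeta> dt * (eta w0 s2 s4 s5
      + \<zeta> * dt / 2 * (s2 - 1)^2 * (s4 - 1) * (s5 - 1))"

definition delta_bar :: "real \<Rightarrow> real \<Rightarrow> real \<Rightarrow> real \<Rightarrow> real \<Rightarrow> real \<Rightarrow> real" where
  "delta_bar \<zeta> dt w0 s2 s4 s5 =
    mu \<zeta> dt * delta w0 s2 s4 s5"

end

theory Submission
  imports Defs
begin

text \<open>
  In moment space the relaxation is diagonal, so five facts describe the collision: the total
  density changes by the source only, the momenta \<open>f\<^sub>1 - f\<^sub>3\<close> and \<open>f\<^sub>2 - f\<^sub>4\<close> are multiplied by
  \<open>a = 1 - s\<^sub>2\<close>, the difference of the axis densities \<open>A = f\<^sub>1 + f\<^sub>3\<close> and \<open>B = f\<^sub>2 + f\<^sub>4\<close> is multiplied by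
  \<open>d = 1 - s\<^sub>5\<close>, and the rest population is multiplied by \<open>b = 1 - s\<^sub>4\<close> up to a local affine function
  of \<open>\<phi>\<close> (\<open>post_collision_moments\<close>). The rate \<open>s\<^sub>1\<close> cancels: the shift of \<open>\<phi>\<close> by half a source term is
  exactly what compensates the relaxation of the density.

  All quantities other than \<open>\<phi>\<close> are then eliminated one after the other, without dividing by any
  expression in the relaxation rates, some of which (such as \<open>a\<close>, \<open>d\<close> or \<open>a + d\<close>) may vanish.
  Write \<open>E\<close> for the time shift and \<open>C\<^sub>x, C\<^sub>y\<close> for the averages over the two neighbours along an axis.

  The momenta go first. Along each axis there are two populations that only move left and right, and
  a two-velocity system is equivalent to a second-order recursion for its density
  (\<open>stream_pair_sum\<close>), a discrete telegraph equation in which \<open>C\<^sub>x\<close> or \<open>C\<^sub>y\<close> is the only spatial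
  operator.

  Next comes the difference \<open>P = A - B\<close>. The two axis recursions give one for \<open>U = A + B\<close>, where \<open>P\<close>
  occurs only as \<open>(a + d) D P\<close> with \<open>D\<close> proportional to \<open>C\<^sub>x - C\<^sub>y\<close>, and one for \<open>P\<close> itself. Applying
  \<open>(a + d) D\<close> to the latter and substituting the former leaves \<open>U\<close> alone
  (\<open>eliminate_difference\<close>). Although \<open>D\<^sup>2\<close> reaches two cells along the axes, these contributions
  cancel against the square of \<open>C\<^sub>x + C\<^sub>y\<close>, because the squares of \<open>C\<^sub>x + C\<^sub>y\<close> and \<open>C\<^sub>x - C\<^sub>y\<close> differ
  by \<open>4 C\<^sub>x C\<^sub>y\<close>, which is \<open>Sigma2\<close>. This is why the scheme needs only \<open>Sigma1\<close> and \<open>Sigma2\<close>.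

  Finally, the rest population is not transported, so that \<open>E - b\<close> turns it into a local function of
  \<open>\<phi>\<close>. Applying \<open>E - b\<close> to the recursion for \<open>U\<close> costs the sixth time level and gives a linear
  relation in \<open>\<phi>\<close> only (\<open>eliminate_rest_population\<close>). Its coefficients are products of those of the
  steps above; dividing by \<open>1 - \<zeta> \<Delta>t / 2\<close>, the coefficient of the newest value, gives the scheme.
\<close>

section \<open>Moments of the collision step\<close>

lemma UNIV_5: "(UNIV :: 5 set) = {0, 1, 2, 3, 4}"
proof -
  have "card {0, 1, 2, 3, 4 :: 5} = CARD(5)" by simp
  then show ?thesis by (metis card_subset_eq finite subset_UNIV)
qed

lemma sum_5: "(\<Sum>k\<in>UNIV. h k) = h 0 + h 1 + h 2 + h 3 + h (4 :: 5)"
  unfolding UNIV_5 by (simp add: add.assoc)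

lemma forall_5: "(\<forall>k. P k) \<longleftrightarrow> P 0 \<and> P 1 \<and> P 2 \<and> P 3 \<and> P (4 :: 5)"
  by (metis UNIV_5 UNIV_I empty_iff insert_iff)

lemma vec5_nth [simp]:
  "vec5 a0 a1 a2 a3 a4 $ 0 = a0" "vec5 a0 a1 a2 a3 a4 $ 1 = a1" "vec5 a0 a1 a2 a3 a4 $ 2 = a2"
  "vec5 a0 a1 a2 a3 a4 $ 3 = a3" "vec5 a0 a1 a2 a3 a4 $ 4 = a4"
  by (simp_all add: vec5_def)

lemma invertible_moment_matrix:
  assumes "c \<noteq> 0"
  shows "invertible (moment_matrix c)"
proof -
  define N where "N = vec5
    (vec5 (1/5) 0 0 (- 1 / (5 * c^2)) 0)
    (vec5 (1/5) (1 / (2 * c)) 0 (1 / (20 * c^2)) (1 / (4 * c^2)))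
    (vec5 (1/5) 0 (1 / (2 * c)) (1 / (20 * c^2)) (- 1 / (4 * c^2)))
    (vec5 (1/5) (- 1 / (2 * c)) 0 (1 / (20 * c^2)) (1 / (4 * c^2)))
    (vec5 (1/5) 0 (- 1 / (2 * c)) (1 / (20 * c^2)) (- 1 / (4 * c^2)))"
  have "moment_matrix c ** N = mat 1"
    using assms
    by (simp add: vec_eq_iff forall_5 matrix_matrix_mult_def mat_def sum_5
        moment_matrix_def N_def)
  then show ?thesis
    using invertible_right_inverse by blast
qed

text \<open>
  The collision matrix is conjugate to the diagonal relaxation matrix, so the moments of a relaxed
  vector can be read off without computing any of its entries.
\<close>
lemma moment_matrix_collision_matrix:
  assumes "c \<noteq> 0"
  shows "(moment_matrix c *v (collision_matrix c s1 s2 s4 s5 *v x)) $ k =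
    vec5 s1 s2 s2 s4 s5 $ k * (moment_matrix c *v x) $ k"
proof -
  have "moment_matrix c ** matrix_inv (moment_matrix c) = mat 1"
    using someI_ex[OF invertible_moment_matrix[OF assms, unfolded invertible_def]]
    by (simp add: matrix_inv_def)
  then have "moment_matrix c ** collision_matrix c s1 s2 s4 s5 =
      relaxation_matrix s1 s2 s4 s5 ** moment_matrix c"
    unfolding collision_matrix_def by (simp add: matrix_mul_assoc)
  then have "moment_matrix c *v (collision_matrix c s1 s2 s4 s5 *v x) =
      relaxation_matrix s1 s2 s4 s5 *v (moment_matrix c *v x)"
    by (simp add: matrix_vector_mul_assoc)
  moreover have "(relaxation_matrix s1 s2 s4 s5 *v y) $ k = vec5 s1 s2 s2 s4 s5 $ k * y $ k" for y
  proof -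
    have "(relaxation_matrix s1 s2 s4 s5 *v y) $ k =
        (\<Sum>i\<in>UNIV. if k = i then vec5 s1 s2 s2 s4 s5 $ k * y $ i else 0)"
      unfolding relaxation_matrix_def matrix_vector_mult_def
      by (simp add: if_distrib[where f = "\<lambda>x. x * _"] cong: if_cong)
    then show ?thesis by simp
  qed
  ultimately show ?thesis by simp
qed

definition post_collision ::
  "real ^ 5 ^ 5 \<Rightarrow> real \<Rightarrow> real \<Rightarrow> real \<Rightarrow> real \<Rightarrow> real ^ 5 \<Rightarrow> real ^ 5" where
  "post_collision L dt \<zeta> R w0 g =
    (let u = macroscopic \<zeta> R dt g; src = source_term w0 \<zeta> R u in
     g - L *v (g - equilibrium w0 u) + dt *\<^sub>R (src - (1 / 2) *\<^sub>R (L *v src)))"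

lemma evolution_streaming:
  assumes "MRT_LB_evolution dx dt \<zeta> R w0 s1 s2 s4 s5 f"
    and "r \<in> lattice dx" and "t \<in> time_levels dt"
  shows "f (r + dt *\<^sub>R (velocity (dx / dt) $ k)) (t + dt) $ k =
    post_collision (collision_matrix (dx / dt) s1 s2 s4 s5) dt \<zeta> R w0 (f r t) $ k"
proof -
  define L where "L = collision_matrix (dx / dt) s1 s2 s4 s5"
  define u where "u = macroscopic \<zeta> R dt (f r t)"
  have "(mat 1 - (1 / 2) *\<^sub>R L) *v x = x - (1 / 2) *\<^sub>R (L *v x)" for x
    by (simp add: matrix_vector_mult_diff_rdistrib scaleR_matrix_vector_assoc)
  then have "(\<Sum>i\<in>UNIV. (mat 1 - (1 / 2) *\<^sub>R L) $ k $ i * x $ i) =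
      (x - (1 / 2) *\<^sub>R (L *v x)) $ k" for x
    by (metis (no_types, lifting) matrix_vector_mult_def sum.cong vec_lambda_beta)
  moreover have "(\<Sum>i\<in>UNIV. L $ k $ i * (f r t $ i - equilibrium w0 u $ i)) =
      (L *v (f r t - equilibrium w0 u)) $ k"
    by (simp add: matrix_vector_mult_def)
  ultimately show ?thesis
    using assms unfolding MRT_LB_evolution_def Let_def post_collision_def
    by (simp add: L_def u_def)
qed

text \<open>
  The lattice speed \<open>c\<close> only scales rows of the moment matrix and drops out. The fourth moment is
  replaced by the rest population, which is a combination of it and the density: since the density
  before relaxation is \<open>u\<close> minus half a source term, its part in the combination relaxes as if its
  rate were \<open>s4\<close> too, and only the equilibrium and source of the rest population remain.
\<close>
lemma post_collision_moments:
  fixes c \<zeta> dt R w0 s1 s2 s4 s5 :: real and g :: "real ^ 5"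
  assumes "c \<noteq> 0" and "\<zeta> * dt \<noteq> 2"
  defines "u \<equiv> macroscopic \<zeta> R dt g"
    and "h \<equiv> post_collision (collision_matrix c s1 s2 s4 s5) dt \<zeta> R w0 g"
  shows "h $ 0 + h $ 1 + h $ 2 + h $ 3 + h $ 4 =
      g $ 0 + g $ 1 + g $ 2 + g $ 3 + g $ 4 + dt * (\<zeta> * u + R)"
    and "h $ 1 - h $ 3 = (1 - s2) * (g $ 1 - g $ 3)"
    and "h $ 2 - h $ 4 = (1 - s2) * (g $ 2 - g $ 4)"
    and "(h $ 1 + h $ 3) - (h $ 2 + h $ 4) = (1 - s5) * ((g $ 1 + g $ 3) - (g $ 2 + g $ 4))"
    and "h $ 0 = (1 - s4) * g $ 0 + w0 * (s4 * u + dt * (1 - s4 / 2) * (\<zeta> * u + R))"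
proof -
  define M where "M = moment_matrix c"
  define src where "src = source_term w0 \<zeta> R u"
  define s where "s = vec5 s1 s2 s2 s4 s5"
  have m: "(M *v h) $ k = (M *v g) $ k - s $ k * (M *v (g - equilibrium w0 u)) $ k
      + dt * (1 - s $ k / 2) * (M *v src) $ k" for k
    unfolding h_def post_collision_def Let_def M_def s_def src_def u_def
    by (simp add: matrix_vector_right_distrib matrix_vector_mult_diff_distrib
        matrix_vector_mult_scaleR moment_matrix_collision_matrix[OF assms(1)] algebra_simps)
  have rho: "g $ 0 + g $ 1 + g $ 2 + g $ 3 + g $ 4 = (1 - \<zeta> * dt / 2) * u - dt / 2 * R"
    using assms(2) by (simp add: u_def macroscopic_def sum_5 field_simps)
  note component = matrix_vector_mult_def moment_matrix_def sum_5
  have M: "(M *v x) $ 0 = x $ 0 + x $ 1 + x $ 2 + x $ 3 + x $ 4"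
    "(M *v x) $ 1 = c * (x $ 1 - x $ 3)" "(M *v x) $ 2 = c * (x $ 2 - x $ 4)"
    "(M *v x) $ 3 = c^2 * (x $ 1 + x $ 2 + x $ 3 + x $ 4 - 4 * x $ 0)"
    "(M *v x) $ 4 = c^2 * ((x $ 1 + x $ 3) - (x $ 2 + x $ 4))" for x
    by (simp_all add: M_def component algebra_simps)
  have eq: "equilibrium w0 u $ 0 = w0 * u" "src $ 0 = w0 * (\<zeta> * u + R)"
    "k \<in> {1, 2, 3, 4} \<Longrightarrow> equilibrium w0 u $ k = (1 - w0) / 4 * u"
    "k \<in> {1, 2, 3, 4} \<Longrightarrow> src $ k = (1 - w0) / 4 * (\<zeta> * u + R)" for k
    by (auto simp: src_def source_term_def equilibrium_def weight_def)
  have s: "s $ 0 = s1" "s $ 1 = s2" "s $ 2 = s2" "s $ 3 = s4" "s $ 4 = s5"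
    by (simp_all add: s_def)
  define tot where "tot x = x $ 0 + x $ 1 + x $ 2 + x $ 3 + x $ 4" for x :: "real ^ 5"
  have tot: "tot (g - equilibrium w0 u) = tot g - u" "tot src = \<zeta> * u + R"
    by (simp_all add: tot_def eq field_simps)
  have "tot h = tot g - s1 * (tot g - u) + dt * (1 - s1 / 2) * (\<zeta> * u + R)"
    using m[of 0] unfolding M(1)[folded tot_def] s tot .
  \<comment> \<open>The departure of the density from \<open>u\<close> is minus half a source term, so \<open>s1\<close> cancels.\<close>
  moreover have "tot g - u = - (dt / 2) * (\<zeta> * u + R)"
    unfolding tot_def rho by (simp add: field_simps)
  ultimately have "tot h = tot g + dt * (\<zeta> * u + R)"
    by (simp add: field_simps)
  then show sum: "h $ 0 + h $ 1 + h $ 2 + h $ 3 + h $ 4 =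
      g $ 0 + g $ 1 + g $ 2 + g $ 3 + g $ 4 + dt * (\<zeta> * u + R)"
    unfolding tot_def .
  have "c * (h $ 1 - h $ 3) = c * ((1 - s2) * (g $ 1 - g $ 3))"
    using m[of 1] by (simp add: M s eq) (simp add: algebra_simps)
  then show "h $ 1 - h $ 3 = (1 - s2) * (g $ 1 - g $ 3)"
    using assms(1) by simp
  have "c * (h $ 2 - h $ 4) = c * ((1 - s2) * (g $ 2 - g $ 4))"
    using m[of 2] by (simp add: M s eq) (simp add: algebra_simps)
  then show "h $ 2 - h $ 4 = (1 - s2) * (g $ 2 - g $ 4)"
    using assms(1) by simp
  have "c^2 * ((h $ 1 + h $ 3) - (h $ 2 + h $ 4)) =
      c^2 * ((1 - s5) * ((g $ 1 + g $ 3) - (g $ 2 + g $ 4)))"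
    using m[of 4] unfolding M s by (simp add: eq) (simp add: algebra_simps)
  then show "(h $ 1 + h $ 3) - (h $ 2 + h $ 4) = (1 - s5) * ((g $ 1 + g $ 3) - (g $ 2 + g $ 4))"
    using assms(1) by simp
  define e where "e x = x $ 1 + x $ 2 + x $ 3 + x $ 4 - 4 * x $ 0" for x :: "real ^ 5"
  have e: "e (g - equilibrium w0 u) = e g - (1 - 5 * w0) * u"
    "e src = (1 - 5 * w0) * (\<zeta> * u + R)"
    by (simp_all add: e_def eq field_simps)
  have "c^2 * e h = c^2 * (e g - s4 * (e g - (1 - 5 * w0) * u)
      + dt * (1 - s4 / 2) * ((1 - 5 * w0) * (\<zeta> * u + R)))"
    using m[of 3] unfolding M(4)[folded e_def] s e by algebra
  then have eh: "e h = e g - s4 * (e g - (1 - 5 * w0) * u)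
      + dt * (1 - s4 / 2) * ((1 - 5 * w0) * (\<zeta> * u + R))"
    using assms(1) by (metis mult_left_cancel zero_eq_power2)
  then show "h $ 0 = (1 - s4) * g $ 0 + w0 * (s4 * u + dt * (1 - s4 / 2) * (\<zeta> * u + R))"
  proof -
    have "e h = (1 - \<zeta> * dt / 2) * u - dt / 2 * R + dt * (\<zeta> * u + R) - 5 * h $ 0"
      using sum rho by (simp add: e_def)
    moreover have "e g = (1 - \<zeta> * dt / 2) * u - dt / 2 * R - 5 * g $ 0"
      using rho by (simp add: e_def)
    ultimately show ?thesis
      using eh by algebra
  qed
qed

section \<open>Elimination of the non-conserved moments\<close>

text \<open>
  After streaming, the momentum on each of the two neighbours of \<open>i\<close> is, up to sign, the density there
  minus twice the population that came from \<open>i\<close> one step before. These two populations add up to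
  the density after collision at \<open>i\<close>, which closes the recursion for the density.
\<close>
lemma stream_pair_sum:
  fixes u v u' v' :: "nat \<Rightarrow> int \<Rightarrow> real" and a :: real
  assumes "\<And>n i. u (Suc n) i = u' n (i - 1)" and "\<And>n i. v (Suc n) i = v' n (i + 1)"
    and "\<And>n i. u' n i - v' n i = a * (u n i - v n i)"
  defines "T \<equiv> \<lambda>n i. u' n i + v' n i + a * (u n i + v n i)"
  shows "u (n + 2) i + v (n + 2) i =
    (T (n + 1) (i - 1) + T (n + 1) (i + 1)) / 2 - a * (u' n i + v' n i)"
proof -
  have "u (n + 2) i = u' (n + 1) (i - 1)" "v (n + 2) i = v' (n + 1) (i + 1)"
    using assms(1)[of "n + 1" i] assms(2)[of "n + 1" i] by simp_all
  moreover have "v (n + 1) (i - 1) = v' n i" "u (n + 1) (i + 1) = u' n i"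
    using assms(2)[of n "i - 1"] assms(1)[of n "i + 1"] by simp_all
  ultimately show ?thesis
    using assms(3)[of "n + 1" "i - 1"] assms(3)[of "n + 1" "i + 1"]
    unfolding T_def by (simp add: field_simps)
qed

text \<open>
  Primes denote values after collision. Let \<open>D\<close> be the neighbour sum along the first axis minus that
  along the second. The difference \<open>A - B\<close> can be eliminated without a division because the recursion
  for \<open>A + B\<close> contains it only through \<open>(a + d) * D (A - B)\<close>, while the recursion for \<open>A - B\<close> has
  coefficients that commute with this operator. Both \<open>U\<close> and \<open>U'\<close> occur in the result since the relation
  between the two still involves the rest population. The factor 4 clears the denominators.
\<close>
lemma eliminate_difference:
  fixes A B A' B' :: "nat \<Rightarrow> int \<Rightarrow> int \<Rightarrow> real" and a d :: real
  assumes A: "\<And>n i j. A (n + 2) i j =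
      (A' (n + 1) (i - 1) j + a * A (n + 1) (i - 1) j
        + A' (n + 1) (i + 1) j + a * A (n + 1) (i + 1) j) / 2 - a * A' n i j"
    and B: "\<And>n i j. B (n + 2) i j =
      (B' (n + 1) i (j - 1) + a * B (n + 1) i (j - 1)
        + B' (n + 1) i (j + 1) + a * B (n + 1) i (j + 1)) / 2 - a * B' n i j"
    and P: "\<And>n i j. A' n i j - B' n i j = d * (A n i j - B n i j)"
  defines "U \<equiv> \<lambda>n i j. A n i j + B n i j" and "U' \<equiv> \<lambda>n i j. A' n i j + B' n i j"
  shows "4 * U (n + 4) i j =
      Sigma1 (U' (n + 3)) i j + (2 * a + d) * Sigma1 (U (n + 3)) i j
      + a * (a + 2 * d) * Sigma1 (U' (n + 1)) i j + a^2 * d * Sigma1 (U (n + 1)) i j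
      - (a + d) * (Sigma2 (U' (n + 2)) i j + a * Sigma2 (U (n + 2)) i j)
      - 4 * (a * U' (n + 2) i j + a * d * U (n + 2) i j + a^2 * d * U' n i j)"
proof -
  define P where "P n i j = A n i j - B n i j" for n i j
  define V where "V n i j = U' n i j + a * U n i j" for n i j
  define D where "D u i j = u (i - 1) j + u (i + 1) j - u i (j - 1) - u i (j + 1)"
    for u :: "int \<Rightarrow> int \<Rightarrow> real" and i j
  have AB: "A n i j = (U n i j + P n i j) / 2" "B n i j = (U n i j - P n i j) / 2"
    "A' n i j = (U' n i j + d * P n i j) / 2" "B' n i j = (U' n i j - d * P n i j) / 2" for n i j
    using P[of n i j] by (simp_all add: U_def U'_def P_def)
  have sum_rec: "4 * U (n + 2) i j =
      Sigma1 (V (n + 1)) i j + (a + d) * D (P (n + 1)) i j - 4 * a * U' n i j" for n i j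
  proof -
    have "4 * U (n + 2) i j = 4 * (A (n + 2) i j + B (n + 2) i j)"
      by (simp add: U_def)
    also have "\<dots> = Sigma1 (V (n + 1)) i j + (a + d) * D (P (n + 1)) i j - 4 * a * U' n i j"
      unfolding A B unfolding AB V_def D_def Sigma1_def by (simp add: divide_simps, algebra)
    finally show ?thesis .
  qed
  have diff_rec: "4 * P (n + 2) i j =
      D (V (n + 1)) i j + (a + d) * Sigma1 (P (n + 1)) i j - 4 * a * d * P n i j" for n i j
  proof -
    have "4 * P (n + 2) i j = 4 * (A (n + 2) i j - B (n + 2) i j)"
      by (simp add: P_def)
    also have "\<dots> = D (V (n + 1)) i j + (a + d) * Sigma1 (P (n + 1)) i j - 4 * a * d * P n i j"
      unfolding A B unfolding AB V_def D_def Sigma1_def by (simp add: divide_simps, algebra)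
    finally show ?thesis .
  qed
  have "4 * ((a + d) * D (P (n + 3)) i j) = (a + d) * D (\<lambda>i j. 4 * P (n + 3) i j) i j"
    by (simp add: D_def)
  also have "(\<lambda>i j. 4 * P (n + 3) i j) =
      (\<lambda>i j. D (V (n + 2)) i j + (a + d) * Sigma1 (P (n + 2)) i j - 4 * a * d * P (n + 1) i j)"
    using diff_rec[of "n + 1"] by (simp add: fun_eq_iff eval_nat_numeral)
  also have "(a + d) * D \<dots> i j = (a + d) * D (D (V (n + 2))) i j
      + (a + d) * Sigma1 (\<lambda>i j. (a + d) * D (P (n + 2)) i j) i j
      - 4 * a * d * ((a + d) * D (P (n + 1)) i j)"
    unfolding D_def Sigma1_def by algebra
  \<comment> \<open>The identity \<open>(x - y)\<^sup>2 = (x + y)\<^sup>2 - 4 x y\<close> for the neighbour sums along the two axes, whose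
    product is \<open>Sigma2\<close>; the iterated \<open>Sigma1\<close> cancels against the one that comes from \<open>sum_rec\<close>.\<close>
  also have "D (D (V (n + 2))) i j = Sigma1 (Sigma1 (V (n + 2))) i j - 4 * Sigma2 (V (n + 2)) i j"
    by (simp add: D_def Sigma1_def Sigma2_def)
  also have "(\<lambda>i j. (a + d) * D (P (n + 2)) i j) =
      (\<lambda>i j. 4 * U (n + 3) i j - Sigma1 (V (n + 2)) i j + 4 * a * U' (n + 1) i j)"
    using sum_rec[of "n + 1"] by (simp add: fun_eq_iff eval_nat_numeral)
  also have "Sigma1 \<dots> i j = 4 * Sigma1 (U (n + 3)) i j - Sigma1 (Sigma1 (V (n + 2))) i j
      + 4 * a * Sigma1 (U' (n + 1)) i j"
    unfolding Sigma1_def by algebra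
  also have "(a + d) * D (P (n + 1)) i j =
      4 * U (n + 2) i j - Sigma1 (V (n + 1)) i j + 4 * a * U' n i j"
    using sum_rec[of n] by simp
  finally have DP: "(a + d) * D (P (n + 3)) i j =
      (a + d) * (Sigma1 (U (n + 3)) i j + a * Sigma1 (U' (n + 1)) i j - Sigma2 (V (n + 2)) i j)
      - a * d * (4 * U (n + 2) i j - Sigma1 (V (n + 1)) i j + 4 * a * U' n i j)"
    by algebra
  have top: "4 * U (n + 4) i j =
      Sigma1 (V (n + 3)) i j + (a + d) * D (P (n + 3)) i j - 4 * a * U' (n + 2) i j"
    using sum_rec[of "n + 2"] by (simp add: eval_nat_numeral)
  have SV: "Sigma1 (V m) i j = Sigma1 (U' m) i j + a * Sigma1 (U m) i j"
    "Sigma2 (V m) i j = Sigma2 (U' m) i j + a * Sigma2 (U m) i j" for m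
    unfolding V_def Sigma1_def Sigma2_def by algebra+
  show ?thesis
    unfolding top DP SV by algebra
qed

text \<open>
  The recursion for \<open>U\<close> has constant coefficients, so it also holds for the image of \<open>(U, U')\<close> under the
  time operator \<open>E - b\<close>. That operator replaces the rest population \<open>r\<close> by its forcing \<open>F\<close>, so that
  the images \<open>Q\<close> and \<open>Q'\<close> are known once the densities and the forcing are. After collision the rest
  population is already the one of the next time level, hence the shifts in \<open>\<rho>'\<close> and in \<open>Q'\<close>.
\<close>
lemma eliminate_rest_population:
  fixes U U' r F \<rho> \<rho>' :: "nat \<Rightarrow> int \<Rightarrow> int \<Rightarrow> real" and a b d :: real
  assumes U: "\<And>n i j. 4 * U (n + 4) i j =
      Sigma1 (U' (n + 3)) i j + (2 * a + d) * Sigma1 (U (n + 3)) i j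
      + a * (a + 2 * d) * Sigma1 (U' (n + 1)) i j + a^2 * d * Sigma1 (U (n + 1)) i j
      - (a + d) * (Sigma2 (U' (n + 2)) i j + a * Sigma2 (U (n + 2)) i j)
      - 4 * (a * U' (n + 2) i j + a * d * U (n + 2) i j + a^2 * d * U' n i j)"
    and r: "\<And>n i j. r (Suc n) i j = b * r n i j + F n i j"
    and \<rho>: "\<And>n i j. \<rho> n i j = r n i j + U n i j"
    and \<rho>': "\<And>n i j. \<rho>' n i j = r (Suc n) i j + U' n i j"
  defines "Q \<equiv> \<lambda>n i j. \<rho> (n + 1) i j - b * \<rho> n i j - F n i j"
    and "Q' \<equiv> \<lambda>n i j. \<rho>' (n + 1) i j - b * \<rho>' n i j - F (n + 1) i j"
  shows "4 * Q (n + 4) i j =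
      Sigma1 (Q' (n + 3)) i j + (2 * a + d) * Sigma1 (Q (n + 3)) i j
      + a * (a + 2 * d) * Sigma1 (Q' (n + 1)) i j + a^2 * d * Sigma1 (Q (n + 1)) i j
      - (a + d) * (Sigma2 (Q' (n + 2)) i j + a * Sigma2 (Q (n + 2)) i j)
      - 4 * (a * Q' (n + 2) i j + a * d * Q (n + 2) i j + a^2 * d * Q' n i j)"
proof -
  have Q: "Q m i j = U (Suc m) i j - b * U m i j" and Q': "Q' m i j = U' (Suc m) i j - b * U' m i j"
    for m i j
    by (simp_all add: Q_def Q'_def \<rho> \<rho>' r algebra_simps)
  have S: "Sigma1 (Q m) i j = Sigma1 (U (Suc m)) i j - b * Sigma1 (U m) i j"
    "Sigma1 (Q' m) i j = Sigma1 (U' (Suc m)) i j - b * Sigma1 (U' m) i j"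
    "Sigma2 (Q m) i j = Sigma2 (U (Suc m)) i j - b * Sigma2 (U m) i j"
    "Sigma2 (Q' m) i j = Sigma2 (U' (Suc m)) i j - b * Sigma2 (U' m) i j" for m
    by (simp_all add: Sigma1_def Sigma2_def Q Q' algebra_simps)
  have "4 * U (Suc (n + 4)) i j =
      Sigma1 (U' (Suc (n + 3))) i j + (2 * a + d) * Sigma1 (U (Suc (n + 3))) i j
      + a * (a + 2 * d) * Sigma1 (U' (Suc (n + 1))) i j + a^2 * d * Sigma1 (U (Suc (n + 1))) i j
      - (a + d) * (Sigma2 (U' (Suc (n + 2))) i j + a * Sigma2 (U (Suc (n + 2))) i j)
      - 4 * (a * U' (Suc (n + 2)) i j + a * d * U (Suc (n + 2)) i j + a^2 * d * U' (Suc n) i j)"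
    using U[of "Suc n" i j] unfolding add_Suc .
  moreover have "4 * Q (n + 4) i j = 4 * U (Suc (n + 4)) i j - b * (4 * U (n + 4) i j)"
    by (simp add: Q)
  ultimately show ?thesis
    unfolding Q Q' S U[of n i j] by algebra
qed

section \<open>The finite-difference scheme\<close>

lemma lattice_streaming:
  fixes f dx dt \<zeta> R w0 s1 s2 s4 s5
  assumes "MRT_LB_evolution dx dt \<zeta> R w0 s1 s2 s4 s5 f" and "dt > 0"
  defines "G \<equiv> \<lambda>n i j. f (of_int i * dx, of_int j * dx) (of_nat n * dt)"
    and "H \<equiv> \<lambda>n i j. post_collision (collision_matrix (dx / dt) s1 s2 s4 s5) dt \<zeta> R w0
      (f (of_int i * dx, of_int j * dx) (of_nat n * dt))"
  shows "G (Suc n) i j $ 0 = H n i j $ 0"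
    "G (Suc n) i j $ 1 = H n (i - 1) j $ 1" "G (Suc n) i j $ 2 = H n i (j - 1) $ 2"
    "G (Suc n) i j $ 3 = H n (i + 1) j $ 3" "G (Suc n) i j $ 4 = H n i (j + 1) $ 4"
proof -
  have step: "f ((of_int i * dx, of_int j * dx) + dt *\<^sub>R (velocity (dx / dt) $ k))
      (of_nat n * dt + dt) $ k = H n i j $ k" for i j k
    unfolding H_def
    by (rule evolution_streaming[OF assms(1)]) (auto simp: lattice_def time_levels_def)
  show "G (Suc n) i j $ 0 = H n i j $ 0"
    "G (Suc n) i j $ 1 = H n (i - 1) j $ 1" "G (Suc n) i j $ 2 = H n i (j - 1) $ 2"
    "G (Suc n) i j $ 3 = H n (i + 1) j $ 3" "G (Suc n) i j $ 4 = H n i (j + 1) $ 4"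
    using step[of i j 0] step[of "i - 1" j 1] step[of i "j - 1" 2]
      step[of "i + 1" j 3] step[of i "j + 1" 4] \<open>dt > 0\<close>
    by (simp_all add: G_def velocity_def algebra_simps)
qed

text \<open>
  The coefficients of the scheme in factored form: \<open>a\<close> and \<open>d\<close> come from the elimination of the momenta
  and of the axis difference, the remaining factors from that of the rest population. In the images \<open>Q\<close>
  and \<open>Q'\<close> of the densities before and after collision, \<open>q1, q0\<close> and \<open>p1, p0\<close> are, up to sign, the
  coefficients of \<open>\<phi>\<close> at the later and the earlier time level, and \<open>qc, pc\<close> those of \<open>dt * R\<close>. A constant
  counts four times in \<open>Sigma1\<close> and \<open>Sigma2\<close>, which explains its factor in \<open>delta_bar\<close>.
\<close>
lemma scheme_coefficients:
  fixes \<zeta> dt w0 s2 s4 s5 :: real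
  defines "a \<equiv> 1 - s2" and "b \<equiv> 1 - s4" and "d \<equiv> 1 - s5"
  defines "q1 \<equiv> 1 - \<zeta> * dt / 2"
    and "q0 \<equiv> b * (1 - \<zeta> * dt / 2) + w0 * (s4 + dt * (1 - s4 / 2) * \<zeta>)"
    and "qc \<equiv> - (s4 / 2 + w0 * (1 - s4 / 2))"
    and "p1 \<equiv> 1 + \<zeta> * dt / 2 - w0 * (s4 + dt * (1 - s4 / 2) * \<zeta>)"
    and "p0 \<equiv> b * (1 + \<zeta> * dt / 2)"
    and "pc \<equiv> s4 / 2 - w0 * (1 - s4 / 2)"
  shows
    "alpha1_bar \<zeta> dt w0 s2 s4 s5 = mu \<zeta> dt * q0"
    "alpha2_bar \<zeta> dt w0 s2 s4 s5 = mu \<zeta> dt * ((p1 + (2 * a + d) * q1) / 4)"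
    "beta1_bar \<zeta> dt w0 s2 s4 s5 = mu \<zeta> dt * (- a * (p1 + d * q1))"
    "beta2_bar \<zeta> dt w0 s2 s4 s5 = mu \<zeta> dt * (- (p0 + (2 * a + d) * q0) / 4)"
    "beta3_bar \<zeta> dt w0 s2 s4 s5 = mu \<zeta> dt * (- (a + d) * (p1 + a * q1) / 4)"
    "gamma1_bar \<zeta> dt w0 s2 s4 s5 = mu \<zeta> dt * (a * (p0 + d * q0))"
    "gamma2_bar \<zeta> dt w0 s2 s4 s5 = mu \<zeta> dt * (a * ((a + 2 * d) * p1 + a * d * q1) / 4)"
    "gamma3_bar \<zeta> dt w0 s2 s4 s5 = mu \<zeta> dt * ((a + d) * (p0 + a * q0) / 4)"
    "zeta1_bar \<zeta> dt w0 s2 s4 s5 = mu \<zeta> dt * (- (a^2) * d * p1)"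
    "zeta2_bar \<zeta> dt w0 s2 s4 s5 = mu \<zeta> dt * (- a * ((a + 2 * d) * p0 + a * d * q0) / 4)"
    "eta_bar \<zeta> dt w0 s2 s4 s5 = mu \<zeta> dt * (a^2 * d * p0)"
    "delta_bar \<zeta> dt w0 s2 s4 s5 = mu \<zeta> dt *
      (- (1 - (2 * a + d) + a * d + (a + d) * a - a^2 * d) * qc
         + (1 + a * (a + 2 * d) - (a + d) - a - a^2 * d) * pc)"
proof -
  note mu_cong = arg_cong[where f = "(*) (mu \<zeta> dt)"]
  note expand = q1_def q0_def qc_def p1_def p0_def pc_def a_def b_def d_def divide_simps
  show "alpha1_bar \<zeta> dt w0 s2 s4 s5 = mu \<zeta> dt * q0"
    unfolding alpha1_bar_def by (rule mu_cong) (simp add: alpha1_def expand, algebra?)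
  show "alpha2_bar \<zeta> dt w0 s2 s4 s5 = mu \<zeta> dt * ((p1 + (2 * a + d) * q1) / 4)"
    unfolding alpha2_bar_def by (rule mu_cong) (simp add: alpha2_def expand, algebra?)
  show "beta1_bar \<zeta> dt w0 s2 s4 s5 = mu \<zeta> dt * (- a * (p1 + d * q1))"
    unfolding beta1_bar_def by (rule mu_cong) (simp add: beta1_def expand, algebra?)
  show "beta2_bar \<zeta> dt w0 s2 s4 s5 = mu \<zeta> dt * (- (p0 + (2 * a + d) * q0) / 4)"
    unfolding beta2_bar_def by (rule mu_cong) (simp add: beta2_def expand, algebra?)
  show "beta3_bar \<zeta> dt w0 s2 s4 s5 = mu \<zeta> dt * (- (a + d) * (p1 + a * q1) / 4)"
    unfolding beta3_bar_def by (rule mu_cong) (simp add: beta3_def expand, algebra?)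
  show "gamma1_bar \<zeta> dt w0 s2 s4 s5 = mu \<zeta> dt * (a * (p0 + d * q0))"
    unfolding gamma1_bar_def by (rule mu_cong) (simp add: gamma1_def expand, algebra?)
  show "gamma2_bar \<zeta> dt w0 s2 s4 s5 = mu \<zeta> dt * (a * ((a + 2 * d) * p1 + a * d * q1) / 4)"
    unfolding gamma2_bar_def by (rule mu_cong) (simp add: gamma2_def expand, algebra?)
  show "gamma3_bar \<zeta> dt w0 s2 s4 s5 = mu \<zeta> dt * ((a + d) * (p0 + a * q0) / 4)"
    unfolding gamma3_bar_def by (rule mu_cong) (simp add: gamma3_def expand, algebra?)
  show "zeta1_bar \<zeta> dt w0 s2 s4 s5 = mu \<zeta> dt * (- (a^2) * d * p1)"
    unfolding zeta1_bar_def by (rule mu_cong) (simp add: zeta1_def expand, algebra?)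
  show "zeta2_bar \<zeta> dt w0 s2 s4 s5 = mu \<zeta> dt * (- a * ((a + 2 * d) * p0 + a * d * q0) / 4)"
    unfolding zeta2_bar_def by (rule mu_cong) (simp add: zeta2_def expand, algebra?)
  show "eta_bar \<zeta> dt w0 s2 s4 s5 = mu \<zeta> dt * (a^2 * d * p0)"
    unfolding eta_bar_def by (rule mu_cong) (simp add: eta_def expand, algebra?)
  show "delta_bar \<zeta> dt w0 s2 s4 s5 = mu \<zeta> dt *
      (- (1 - (2 * a + d) + a * d + (a + d) * a - a^2 * d) * qc
         + (1 + a * (a + 2 * d) - (a + d) - a - a^2 * d) * pc)"
    unfolding delta_bar_def by (rule mu_cong) (simp add: delta_def expand, algebra?)
qed

theorem mainTheorem4:
  fixes \<zeta> R dx dt w0 s1 s2 s4 s5 :: real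
    and f :: "real \<times> real \<Rightarrow> real \<Rightarrow> real ^ 5"
    and \<phi> :: "nat \<Rightarrow> int \<Rightarrow> int \<Rightarrow> real"
  assumes "dx > 0" and "dt > 0" and "\<zeta> * dt \<noteq> 2"
    and "w0 \<in> {0<..<1}"
    and "s1 \<in> {0<..<2}" and "s2 \<in> {0<..<2}" and "s4 \<in> {0<..<2}" and "s5 \<in> {0<..<2}"
    and "MRT_LB_evolution dx dt \<zeta> R w0 s1 s2 s4 s5 f"
    and "\<And>n i j. \<phi> n i j = macroscopic \<zeta> R dt (f (of_int i * dx, of_int j * dx) (of_nat n * dt))"
  shows "\<forall>n \<ge> 4. \<forall>i j.
    \<phi> (n + 1) i j =
        alpha1_bar \<zeta> dt w0 s2 s4 s5 * \<phi> n i j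
      + alpha2_bar \<zeta> dt w0 s2 s4 s5 * Sigma1 (\<phi> n) i j
      + beta1_bar \<zeta> dt w0 s2 s4 s5 * \<phi> (n - 1) i j
      + beta2_bar \<zeta> dt w0 s2 s4 s5 * Sigma1 (\<phi> (n - 1)) i j
      + beta3_bar \<zeta> dt w0 s2 s4 s5 * Sigma2 (\<phi> (n - 1)) i j
      + gamma1_bar \<zeta> dt w0 s2 s4 s5 * \<phi> (n - 2) i j
      + gamma2_bar \<zeta> dt w0 s2 s4 s5 * Sigma1 (\<phi> (n - 2)) i j
      + gamma3_bar \<zeta> dt w0 s2 s4 s5 * Sigma2 (\<phi> (n - 2)) i j
      + zeta1_bar \<zeta> dt w0 s2 s4 s5 * \<phi> (n - 3) i j
      + zeta2_bar \<zeta> dt w0 s2 s4 s5 * Sigma1 (\<phi> (n - 3)) i j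
      + eta_bar \<zeta> dt w0 s2 s4 s5 * \<phi> (n - 4) i j
      + dt * delta_bar \<zeta> dt w0 s2 s4 s5 * R"
proof -
  define g where "g k n i j = f (of_int i * dx, of_int j * dx) (of_nat n * dt) $ k"
    for k :: 5 and n i j
  define h where "h k n i j = post_collision (collision_matrix (dx / dt) s1 s2 s4 s5) dt \<zeta> R w0
      (f (of_int i * dx, of_int j * dx) (of_nat n * dt)) $ k" for k :: 5 and n i j
  note stream = lattice_streaming[OF assms(9,2), folded g_def h_def]
  have c: "dx / dt \<noteq> 0" using assms(1,2) by simp
  note collide = post_collision_moments[OF c assms(3), where R = R and ?w0.0 = w0
    and ?s1.0 = s1 and ?s2.0 = s2 and ?s4.0 = s4 and ?s5.0 = s5
    and g = "f (of_int i * dx, of_int j * dx) (of_nat n * dt)" for i j n,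
    folded g_def h_def assms(10)]
  define A B A' B' where "A n i j = g 1 n i j + g 3 n i j" and "B n i j = g 2 n i j + g 4 n i j"
    and "A' n i j = h 1 n i j + h 3 n i j" and "B' n i j = h 2 n i j + h 4 n i j" for n i j
  note AB_def = A_def B_def A'_def B'_def
  define a where "a = 1 - s2"
  define b where "b = 1 - s4"
  define d where "d = 1 - s5"
  have A: "A (n + 2) i j =
      (A' (n + 1) (i - 1) j + a * A (n + 1) (i - 1) j
        + A' (n + 1) (i + 1) j + a * A (n + 1) (i + 1) j) / 2 - a * A' n i j" for n i j
    unfolding AB_def using stream_pair_sum[of "\<lambda>n i. g 1 n i j" "\<lambda>n i. h 1 n i j"
      "\<lambda>n i. g 3 n i j" "\<lambda>n i. h 3 n i j" a n i, OF stream(2,4) collide(2)[folded a_def]]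
    by (simp add: algebra_simps)
  have B: "B (n + 2) i j =
      (B' (n + 1) i (j - 1) + a * B (n + 1) i (j - 1)
        + B' (n + 1) i (j + 1) + a * B (n + 1) i (j + 1)) / 2 - a * B' n i j" for n i j
    unfolding AB_def using stream_pair_sum[of "\<lambda>n j. g 2 n i j" "\<lambda>n j. h 2 n i j"
      "\<lambda>n j. g 4 n i j" "\<lambda>n j. h 4 n i j" a n j, OF stream(3,5) collide(3)[folded a_def]]
    by (simp add: algebra_simps)
  have P: "A' n i j - B' n i j = d * (A n i j - B n i j)" for n i j
    unfolding AB_def d_def by (rule collide(4))
  define F where "F n i j = w0 * (s4 * \<phi> n i j + dt * (1 - s4 / 2) * (\<zeta> * \<phi> n i j + R))" for n i j
  define \<rho> where "\<rho> n i j = (1 - \<zeta> * dt / 2) * \<phi> n i j - dt / 2 * R" for n i j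
  define \<rho>' where "\<rho>' n i j = \<rho> n i j + dt * (\<zeta> * \<phi> n i j + R)" for n i j
  have r: "g 0 (Suc n) i j = b * g 0 n i j + F n i j" for n i j
    unfolding stream(1) F_def b_def by (rule collide(5))
  have \<rho>: "\<rho> n i j = g 0 n i j + (A n i j + B n i j)" for n i j
    using assms(3) by (simp add: \<rho>_def assms(10) macroscopic_def sum_5 AB_def g_def field_simps)
  have \<rho>': "\<rho>' n i j = g 0 (Suc n) i j + (A' n i j + B' n i j)" for n i j
  proof -
    have "h 0 n i j + h 1 n i j + h 2 n i j + h 3 n i j + h 4 n i j =
        g 0 n i j + g 1 n i j + g 2 n i j + g 3 n i j + g 4 n i j + dt * (\<zeta> * \<phi> n i j + R)"
      by (rule collide(1))
    then show ?thesis
      by (simp add: \<rho>'_def \<rho> stream(1) AB_def)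
  qed
  define q1 q0 qc p1 p0 pc where
    "q1 = 1 - \<zeta> * dt / 2"
    and "q0 = b * (1 - \<zeta> * dt / 2) + w0 * (s4 + dt * (1 - s4 / 2) * \<zeta>)"
    and "qc = - (s4 / 2 + w0 * (1 - s4 / 2))"
    and "p1 = 1 + \<zeta> * dt / 2 - w0 * (s4 + dt * (1 - s4 / 2) * \<zeta>)"
    and "p0 = b * (1 + \<zeta> * dt / 2)"
    and "pc = s4 / 2 - w0 * (1 - s4 / 2)"
  define Q Q' where "Q n i j = q1 * \<phi> (n + 1) i j - q0 * \<phi> n i j + qc * (dt * R)"
    and "Q' n i j = p1 * \<phi> (n + 1) i j - p0 * \<phi> n i j + pc * (dt * R)" for n i j
  have Q: "Q = (\<lambda>n i j. \<rho> (n + 1) i j - b * \<rho> n i j - F n i j)"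
    by (simp add: fun_eq_iff Q_def q1_def q0_def qc_def \<rho>_def F_def b_def field_simps)
  have Q': "Q' = (\<lambda>n i j. \<rho>' (n + 1) i j - b * \<rho>' n i j - F (n + 1) i j)"
    by (simp add: fun_eq_iff Q'_def p1_def p0_def pc_def \<rho>'_def \<rho>_def F_def b_def field_simps)
  have rec: "4 * Q (n + 4) i j =
      Sigma1 (Q' (n + 3)) i j + (2 * a + d) * Sigma1 (Q (n + 3)) i j
      + a * (a + 2 * d) * Sigma1 (Q' (n + 1)) i j + a^2 * d * Sigma1 (Q (n + 1)) i j
      - (a + d) * (Sigma2 (Q' (n + 2)) i j + a * Sigma2 (Q (n + 2)) i j)
      - 4 * (a * Q' (n + 2) i j + a * d * Q (n + 2) i j + a^2 * d * Q' n i j)" for n i j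
    unfolding Q Q'
    by (rule eliminate_rest_population[OF eliminate_difference[OF A B P] r \<rho> \<rho>'])
  have S: "Sigma1 (Q n) i j = q1 * Sigma1 (\<phi> (n + 1)) i j - q0 * Sigma1 (\<phi> n) i j + 4 * qc * (dt * R)"
    "Sigma1 (Q' n) i j = p1 * Sigma1 (\<phi> (n + 1)) i j - p0 * Sigma1 (\<phi> n) i j + 4 * pc * (dt * R)"
    "Sigma2 (Q n) i j = q1 * Sigma2 (\<phi> (n + 1)) i j - q0 * Sigma2 (\<phi> n) i j + 4 * qc * (dt * R)"
    "Sigma2 (Q' n) i j = p1 * Sigma2 (\<phi> (n + 1)) i j - p0 * Sigma2 (\<phi> n) i j + 4 * pc * (dt * R)"
    for n i j
    by (simp_all add: Sigma1_def Sigma2_def Q_def Q'_def algebra_simps)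
  have mu: "mu \<zeta> dt * q1 = 1"
    using assms(3) by (simp add: mu_def q1_def field_simps)
  note coeffs = scheme_coefficients[of \<zeta> dt w0 s2 s4 s5, folded a_def b_def d_def,
    folded q1_def q0_def qc_def p1_def p0_def pc_def]
  have step: "\<phi> (n + 5) i j =
        alpha1_bar \<zeta> dt w0 s2 s4 s5 * \<phi> (n + 4) i j
      + alpha2_bar \<zeta> dt w0 s2 s4 s5 * Sigma1 (\<phi> (n + 4)) i j
      + beta1_bar \<zeta> dt w0 s2 s4 s5 * \<phi> (n + 3) i j
      + beta2_bar \<zeta> dt w0 s2 s4 s5 * Sigma1 (\<phi> (n + 3)) i j
      + beta3_bar \<zeta> dt w0 s2 s4 s5 * Sigma2 (\<phi> (n + 3)) i j
      + gamma1_bar \<zeta> dt w0 s2 s4 s5 * \<phi> (n + 2) i j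
      + gamma2_bar \<zeta> dt w0 s2 s4 s5 * Sigma1 (\<phi> (n + 2)) i j
      + gamma3_bar \<zeta> dt w0 s2 s4 s5 * Sigma2 (\<phi> (n + 2)) i j
      + zeta1_bar \<zeta> dt w0 s2 s4 s5 * \<phi> (n + 1) i j
      + zeta2_bar \<zeta> dt w0 s2 s4 s5 * Sigma1 (\<phi> (n + 1)) i j
      + eta_bar \<zeta> dt w0 s2 s4 s5 * \<phi> n i j
      + dt * delta_bar \<zeta> dt w0 s2 s4 s5 * R" (is "_ = ?rhs") for n i j
  proof -
    have idx: "n + 4 + 1 = n + 5" "n + 3 + 1 = n + 4" "n + 2 + 1 = n + 3" "n + 1 + 1 = n + 2"
      by simp_all
    have q1: "4 * (q1 * \<phi> (n + 5) i j) =
        4 * (q0 * \<phi> (n + 4) i j)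
      + (p1 + (2 * a + d) * q1) * Sigma1 (\<phi> (n + 4)) i j
      - 4 * (a * (p1 + d * q1) * \<phi> (n + 3) i j)
      - (p0 + (2 * a + d) * q0) * Sigma1 (\<phi> (n + 3)) i j
      - (a + d) * (p1 + a * q1) * Sigma2 (\<phi> (n + 3)) i j
      + 4 * (a * (p0 + d * q0) * \<phi> (n + 2) i j)
      + a * ((a + 2 * d) * p1 + a * d * q1) * Sigma1 (\<phi> (n + 2)) i j
      + (a + d) * (p0 + a * q0) * Sigma2 (\<phi> (n + 2)) i j
      - 4 * (a^2 * d * p1 * \<phi> (n + 1) i j)
      - a * ((a + 2 * d) * p0 + a * d * q0) * Sigma1 (\<phi> (n + 1)) i j
      + 4 * (a^2 * d * p0 * \<phi> n i j)
      + 4 * ((- (1 - (2 * a + d) + a * d + (a + d) * a - a^2 * d) * qc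
         + (1 + a * (a + 2 * d) - (a + d) - a - a^2 * d) * pc) * (dt * R))"
      using rec[of n i j] unfolding S unfolding Q_def Q'_def idx by algebra
    have "4 * \<phi> (n + 5) i j = mu \<zeta> dt * (4 * (q1 * \<phi> (n + 5) i j))"
      using mu by algebra
    also have "\<dots> = 4 * ?rhs"
      unfolding q1 coeffs by (simp add: divide_simps, algebra)
    finally show ?thesis by simp
  qed
  show ?thesis
  proof (intro allI impI)
    fix n :: nat and i j :: int
    assume "n \<ge> 4"
    then obtain m where m: "n = m + 4"
      by (metis add.commute le_Suc_ex)
    show "\<phi> (n + 1) i j =
        alpha1_bar \<zeta> dt w0 s2 s4 s5 * \<phi> n i j
      + alpha2_bar \<zeta> dt w0 s2 s4 s5 * Sigma1 (\<phi> n) i j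
      + beta1_bar \<zeta> dt w0 s2 s4 s5 * \<phi> (n - 1) i j
      + beta2_bar \<zeta> dt w0 s2 s4 s5 * Sigma1 (\<phi> (n - 1)) i j
      + beta3_bar \<zeta> dt w0 s2 s4 s5 * Sigma2 (\<phi> (n - 1)) i j
      + gamma1_bar \<zeta> dt w0 s2 s4 s5 * \<phi> (n - 2) i j
      + gamma2_bar \<zeta> dt w0 s2 s4 s5 * Sigma1 (\<phi> (n - 2)) i j
      + gamma3_bar \<zeta> dt w0 s2 s4 s5 * Sigma2 (\<phi> (n - 2)) i j
      + zeta1_bar \<zeta> dt w0 s2 s4 s5 * \<phi> (n - 3) i j
      + zeta2_bar \<zeta> dt w0 s2 s4 s5 * Sigma1 (\<phi> (n - 3)) i j
      + eta_bar \<zeta> dt w0 s2 s4 s5 * \<phi> (n - 4) i j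
      + dt * delta_bar \<zeta> dt w0 s2 s4 s5 * R"
      using step[of m i j] by (simp add: m add.commute)
  qed
qed

end
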